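(* Let a finite group $\Gamma$ act on a finite set $X$, and consider a run of the Construction described below which performs $k-1$ iterations, producing the labelling $\phi:X\to\{1,\dots,k\}$, groups $\Gamma_1\supseteq\cdots\supseteq\Gamma_k$ and sets $X_1\supseteq\cdots\supseteq X_k$. Let $2\le j\le k$ and let $y_1,\dots,y_j\in X$ satisfy (1) $\phi(y_i)=i$ for each $i$, and (2) $y_{i+1}\in\Gamma_{i-1}.y_i$ for each $i$ from $2$ to $j-1$, and $y_1\in\Gamma_{j-1}.y_j$. Then $$|\Gamma|\ \ge\ |\Gamma_1.y_2|\,|\Gamma_2.y_3|\cdots|\Gamma_{j-1}.y_j|\,|\Gamma_j.y_1|\,|\mathrm{Stab}_{\Gamma_j}(y_1)|.$$
   Context: For a group $H$ acting on a set $Y$, write $h.y$ for the action, $H.y$ for the orbit, and $\mathrm{Stab}_H(Z)=\{h\in H: h.z=z \text{ for all } z\in Z\}$ (with $\mathrm{Stab}_H(y)=\mathrm{Stab}_H(\{y\})$). Construction: (1) Set $i=1$, $\phi(x)=1$ for all $x\in X$, $\Gamma_1=\Gamma$, $X_1=X$. (2) While some element of $\Gamma_i$ moves some element of $X_i$: (a) choose a subset $X'_{i+1}\subseteq X_i$ containing exactly one element from each $\Gamma_i$-orbit in $X_i$ having at least two elements (and no other elements); (b) set $\phi(x)=i+1$ for each $x\in X'_{i+1}$; (c) set $X_{i+1}=X_i\setminus X'_{i+1}$ and $\Gamma_{i+1}=\mathrm{Stab}_{\Gamma_i}(X'_{i+1})$; (d) increase $i$ by $1$. *)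

theory Defs
  imports "HOL-Algebra.Group_Action"
begin

definition pointwise_stabilizer :: "('a, 'c) monoid_scheme \<Rightarrow> ('a \<Rightarrow> 'b \<Rightarrow> 'b) \<Rightarrow> 'b set \<Rightarrow> 'a set"
  where "pointwise_stabilizer H act Z = {h \<in> carrier H. \<forall>z\<in>Z. act h z = z}"

definition moves_some :: "('a, 'c) monoid_scheme \<Rightarrow> ('a \<Rightarrow> 'b \<Rightarrow> 'b) \<Rightarrow> 'b set \<Rightarrow> bool"
  where "moves_some H act Y \<longleftrightarrow> (\<exists>h\<in>carrier H. \<exists>y\<in>Y. act h y \<noteq> y)"

definition nontrivial_orbits :: "('a, 'c) monoid_scheme \<Rightarrow> ('a \<Rightarrow> 'b \<Rightarrow> 'b) \<Rightarrow> 'b set \<Rightarrow> 'b set set"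
  where "nontrivial_orbits H act Y = {A \<in> orbits H Y act. 2 \<le> card A}"

definition orbit_choice :: "('a, 'c) monoid_scheme \<Rightarrow> ('a \<Rightarrow> 'b \<Rightarrow> 'b) \<Rightarrow> 'b set \<Rightarrow> 'b set \<Rightarrow> bool"
  where "orbit_choice H act Y Y' \<longleftrightarrow>
    Y' \<subseteq> Y \<and> Y' \<subseteq> \<Union>(nontrivial_orbits H act Y) \<and>
    (\<forall>A\<in>nontrivial_orbits H act Y. \<exists>!x. x \<in> Y' \<and> x \<in> A)"

text \<open>
  A complete run of the construction with \<^term>\<open>k - 1\<close> iterations of the while loop.
  The sequences \<open>\<Gamma>\<close> and \<open>Xs\<close> are constrained at the indices \<open>1, \<dots>, k\<close> only.
  \<open>L i\<close> is the state of the labelling when the loop counter is \<open>i\<close>, so that \<open>\<phi>\<close> is its final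
  state; \<open>X' (i + 1)\<close> is the set chosen in the iteration with loop counter \<open>i\<close>.
  The last conjunct says that the loop condition fails at counter \<open>k\<close>.
\<close>

definition construction_run ::
  "('a, 'c) monoid_scheme \<Rightarrow> 'b set \<Rightarrow> ('a \<Rightarrow> 'b \<Rightarrow> 'b) \<Rightarrow> nat \<Rightarrow> ('b \<Rightarrow> nat) \<Rightarrow>
    (nat \<Rightarrow> ('a, 'c) monoid_scheme) \<Rightarrow> (nat \<Rightarrow> 'b set) \<Rightarrow> bool"
  where "construction_run G X act k \<phi> \<Gamma> Xs \<longleftrightarrow>
    1 \<le> k \<and> \<Gamma> 1 = G \<and> Xs 1 = X \<and>
    (\<exists>L X'.
      (\<forall>x\<in>X. L 1 x = 1) \<and>
      (\<forall>i\<in>{1..<k}.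
        moves_some (\<Gamma> i) act (Xs i) \<and>
        orbit_choice (\<Gamma> i) act (Xs i) (X' (i + 1)) \<and>
        (\<forall>x\<in>X. L (i + 1) x = (if x \<in> X' (i + 1) then i + 1 else L i x)) \<and>
        Xs (i + 1) = Xs i - X' (i + 1) \<and>
        \<Gamma> (i + 1) = (\<Gamma> i)\<lparr>carrier := pointwise_stabilizer (\<Gamma> i) act (X' (i + 1))\<rparr>) \<and>
      (\<forall>x\<in>X. \<phi> x = L k x)) \<and>
    \<not> moves_some (\<Gamma> k) act (Xs k)"

end

theory Submission
  imports Defs
begin

text \<open>
  A point \<open>y\<^sub>i\<^sub>+\<^sub>1\<close> with label \<open>i + 1 \<ge> 2\<close> belongs to the set chosen in iteration \<open>i\<close>, so
  \<open>\<Gamma>\<^sub>i\<^sub>+\<^sub>1\<close> is contained in the stabilizer of \<open>y\<^sub>i\<^sub>+\<^sub>1\<close> in \<open>\<Gamma>\<^sub>i\<close>. The orbit-stabilizer theorem then gives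
  \<open>|\<Gamma>\<^sub>i| \<ge> |\<Gamma>\<^sub>i.y\<^sub>i\<^sub>+\<^sub>1| |\<Gamma>\<^sub>i\<^sub>+\<^sub>1|\<close>. Chain these inequalities for \<open>i < j\<close> and apply the
  orbit-stabilizer theorem once more to \<open>\<Gamma>\<^sub>j\<close> acting on \<open>y\<^sub>1\<close>.
\<close>

lemma (in group_action) pointwise_stabilizer_subgroup:
  assumes "Z \<subseteq> E"
  shows "subgroup (pointwise_stabilizer G \<phi> Z) G"
proof -
  interpret G: group G
    using group_hom group_hom.axioms(1) by blast
  have sub: "subgroup (stabilizer G \<phi> z) G" if "z \<in> Z" for z
    using stabilizer_subgroup that assms by blast
  \<comment> \<open>Inserting \<open>carrier G\<close> keeps the intersected family nonempty, and
    the intersection inside the group, even when \<open>Z\<close> is empty.\<close>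
  have eq: "pointwise_stabilizer G \<phi> Z = \<Inter> (insert (carrier G) (stabilizer G \<phi> ` Z))"
    by (auto simp: pointwise_stabilizer_def stabilizer_def)
  show ?thesis
    unfolding eq by (rule G.subgroups_Inter) (use sub G.subgroup_self in auto)
qed

text \<open>One link of the chain: \<open>z\<close> will be \<open>y (i + 1)\<close> and
  \<open>Z\<close> the chosen set containing it. Finiteness turns the inclusion of stabilizers into
  an inequality of cardinalities.\<close>

lemma (in group_action) card_orbit_mult_pointwise_stabilizer_le:
  assumes "finite (carrier G)" and "z \<in> Z" and "z \<in> E"
  shows "card (orbit G \<phi> z) * card (pointwise_stabilizer G \<phi> Z) \<le> order G"
proof -
  have "card (pointwise_stabilizer G \<phi> Z) \<le> card (stabilizer G \<phi> z)"
    by (rule card_mono) (use assms in \<open>auto simp: pointwise_stabilizer_def stabilizer_def\<close>)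
  then show ?thesis
    using orbit_stabilizer_theorem[OF \<open>z \<in> E\<close>] by (metis mult_le_mono2)
qed

text \<open>Labels start at 1, so any other value was written by some iteration, which writes its
  index exactly on the set chosen under that index. Induction on the counter: the latest iteration
  either writes the label or keeps the previous one.\<close>

lemma label_eq_imp_chosen:
  fixes L :: "nat \<Rightarrow> 'b \<Rightarrow> nat"
  assumes "1 \<le> m" and "m \<le> k"
    and "L 1 x = 1"
    and "\<And>i. i \<in> {1..<k} \<Longrightarrow> L (i + 1) x = (if x \<in> X' (i + 1) then i + 1 else L i x)"
    and "L m x \<noteq> 1"
  shows "x \<in> X' (L m x)"
  using assms(1,2,5)
proof (induction m rule: dec_induct)
  case base
  then show ?case using assms(3) by simp
next
  case (step n)
  then show ?case using assms(4)[of n] by (auto split: if_splits)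
qed

theorem theorem2p10:
  fixes G :: "('a, 'c) monoid_scheme"
    and X :: "'b set"
    and act :: "'a \<Rightarrow> 'b \<Rightarrow> 'b"
    and k j :: nat
    and \<phi> :: "'b \<Rightarrow> nat"
    and \<Gamma> :: "nat \<Rightarrow> ('a, 'c) monoid_scheme"
    and Xs :: "nat \<Rightarrow> 'b set"
    and y :: "nat \<Rightarrow> 'b"
  assumes "group_action G X act"
    and "finite (carrier G)"
    and "finite X"
    and "construction_run G X act k \<phi> \<Gamma> Xs"
    and "2 \<le> j" and "j \<le> k"
    and "\<And>i. i \<in> {1..j} \<Longrightarrow> y i \<in> X"
    and "\<And>i. i \<in> {1..j} \<Longrightarrow> \<phi> (y i) = i"
    and "\<And>i. i \<in> {2..j - 1} \<Longrightarrow> y (i + 1) \<in> orbit (\<Gamma> (i - 1)) act (y i)"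
    and "y 1 \<in> orbit (\<Gamma> (j - 1)) act (y j)"
  shows "order G \<ge>
    (\<Prod>i = 1..j - 1. card (orbit (\<Gamma> i) act (y (i + 1)))) *
    card (orbit (\<Gamma> j) act (y 1)) *
    card (stabilizer (\<Gamma> j) act (y 1))"
proof -
  from assms(4) obtain L X' where \<Gamma>1: "\<Gamma> 1 = G" and X1: "Xs 1 = X"
    and L1: "\<And>x. x \<in> X \<Longrightarrow> L 1 x = 1"
    and choice: "\<And>i. i \<in> {1..<k} \<Longrightarrow> orbit_choice (\<Gamma> i) act (Xs i) (X' (i + 1))"
    and LS: "\<And>i x. i \<in> {1..<k} \<Longrightarrow> x \<in> X \<Longrightarrow>
               L (i + 1) x = (if x \<in> X' (i + 1) then i + 1 else L i x)"
    and XS: "\<And>i. i \<in> {1..<k} \<Longrightarrow> Xs (i + 1) = Xs i - X' (i + 1)"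
    and \<Gamma>S: "\<And>i. i \<in> {1..<k} \<Longrightarrow>
               \<Gamma> (i + 1) = (\<Gamma> i)\<lparr>carrier := pointwise_stabilizer (\<Gamma> i) act (X' (i + 1))\<rparr>"
    and \<phi>L: "\<And>x. x \<in> X \<Longrightarrow> \<phi> x = L k x"
    unfolding construction_run_def by blast
  have chosen: "y (i + 1) \<in> X' (i + 1)" if "i \<in> {1..<j}" for i
  proof -
    have y: "y (i + 1) \<in> X" "L k (y (i + 1)) = i + 1"
      using assms(7,8)[of "i + 1"] \<phi>L that by auto
    \<comment> \<open>Taken at the final state \<open>m = k\<close>, where the label
      \<open>i + 1\<close> is at least 2 and hence differs from the initial one.\<close>
    show ?thesis
      using label_eq_imp_chosen[of k k L "y (i + 1)" X'] y L1 LS that assms(6) by auto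
  qed
  \<comment> \<open>Every \<open>\<Gamma> m\<close> acts on all of \<open>X\<close>, not just on
    \<open>Xs m\<close>, so orbit-stabilizer applies to any \<open>y i\<close>. The inclusion
    \<open>Xs m \<subseteq> X\<close> places the next chosen set inside \<open>X\<close>, as needed
    for its pointwise stabilizer to be a subgroup.\<close>
  have invariant: "group_action (\<Gamma> m) X act \<and> finite (carrier (\<Gamma> m)) \<and> Xs m \<subseteq> X \<and>
      (\<Prod>i = 1..<m. card (orbit (\<Gamma> i) act (y (i + 1)))) * order (\<Gamma> m) \<le> order G"
    if "1 \<le> m" "m \<le> j" for m
    using that
  proof (induction m rule: dec_induct)
    case base
    show ?case using assms(1,2) by (simp add: \<Gamma>1[simplified] X1[simplified])
  next
    case (step n)
    then interpret \<Gamma>n: group_action "\<Gamma> n" X act by simp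
    have n: "n \<in> {1..<k}" "n \<in> {1..<j}" using step assms(6) by auto
    have fin: "finite (carrier (\<Gamma> n))" and sub: "Xs n \<subseteq> X"
      and le: "(\<Prod>i = 1..<n. card (orbit (\<Gamma> i) act (y (i + 1)))) * order (\<Gamma> n) \<le> order G"
      using step by auto
    have X'X: "X' (n + 1) \<subseteq> X"
      using choice[OF n(1)] sub by (auto simp: orbit_choice_def)
    have ord: "order (\<Gamma> (Suc n)) = card (pointwise_stabilizer (\<Gamma> n) act (X' (n + 1)))"
      using \<Gamma>S[OF n(1)] by (simp add: order_def)
    have "card (orbit (\<Gamma> n) act (y (n + 1))) * order (\<Gamma> (Suc n)) \<le> order (\<Gamma> n)"
      unfolding ord using \<Gamma>n.card_orbit_mult_pointwise_stabilizer_le fin chosen[OF n(2)] X'X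
      by blast
    then have "(\<Prod>i = 1..<Suc n. card (orbit (\<Gamma> i) act (y (i + 1)))) * order (\<Gamma> (Suc n))
        \<le> (\<Prod>i = 1..<n. card (orbit (\<Gamma> i) act (y (i + 1)))) * order (\<Gamma> n)"
      \<comment> \<open>Here \<open>1 \<le> n\<close> allows the factor at index \<open>n\<close> to
        be split off the product.\<close>
      using step(1) by (simp add: mult.assoc)
    moreover have "group_action (\<Gamma> (Suc n)) X act"
      using \<Gamma>n.induced_action[OF \<Gamma>n.pointwise_stabilizer_subgroup[OF X'X]] \<Gamma>S[OF n(1)] by simp
    moreover have "finite (carrier (\<Gamma> (Suc n)))"
      using \<Gamma>S[OF n(1)] fin by (simp add: pointwise_stabilizer_def)
    moreover have "Xs (Suc n) \<subseteq> X"
      using XS[OF n(1)] sub by auto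
    ultimately show ?case using le by linarith
  qed
  have "card (orbit (\<Gamma> j) act (y 1)) * card (stabilizer (\<Gamma> j) act (y 1)) = order (\<Gamma> j)"
    using group_action.orbit_stabilizer_theorem invariant[of j] assms(5) assms(7)[of 1] by auto
  moreover have "{1..j - 1} = {1..<j}" using assms(5) by auto
  ultimately show ?thesis
    using invariant[of j] assms(5) by (simp add: mult.assoc)
qed

end
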